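(* Let $X$ be a balanced representation of $\Gamma$. (1) We have $\theta(\dim(X))=0$. (2) Let $Y$ be a subrepresentation of $X$ in $\mathrm{rep}(\Gamma)$. Then $\theta(\dim(Y))\le0$, where equality holds if and only if $Y$ is balanced. (3) The representation $X$ is $\theta$-semistable.
   Context: $\mathbb{K}$ is an algebraically closed field, $m\ge 1$, and $A=A_1*\cdots*A_m$ is the free product of finite dimensional semisimple $\mathbb{K}$-algebras $A_i$, none of which is one-dimensional, with $A_i=A_{i1}\times\cdots\times A_{ir_i}$ and $A_{ij}=\mathrm{Mat}_{w_{ij}}(\mathbb{K})$. The quiver $\Gamma=\Gamma_A$ has one sink $v_0$, a source $v_{ij}$ for each $1\le i\le m$, $1\le j\le r_i$, and $w_{ij}$ arrows $\alpha_{ij}^1,\dots,\alpha_{ij}^{w_{ij}}$ from $v_{ij}$ to $v_0$. $\mathrm{rep}(\Gamma)$ is the category of finite dimensional representations of $\Gamma$ over $\mathbb{K}$; $\dim(X)\in\mathbb{Z}_{\ge0}^{\Gamma_0}$ is the dimension vector of $X$. A representation $X$ is balanced if for each $1\le i\le m$ the map $$\Psi(X,i)=\bigoplus_{j=1}^{r_i}\bigoplus_{k=1}^{w_{ij}}X(\alpha_{ij}^k):\bigoplus_{j=1}^{r_i}\bigoplus_{k=1}^{w_{ij}}X(v_{ij})\to X(v_0)$$ is invertible. The stability parameter $\theta\in\mathbb{Z}^{\Gamma_0}$ has $\theta_{v_0}=-m$ and $\theta_{v_{ij}}=w_{ij}$; $\theta(d)=\sum_v\theta_vd_v$. A representation $X$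 is $\theta$-semistable if $\theta(\dim X)=0$ and $\theta(\dim X')\le0$ for every subrepresentation $X'$ of $X$. *)

theory Defs
  imports
    "HOL-Library.FuncSet"
    "HOL-Computational_Algebra.Polynomial"
    "Graph_Theory.Digraph"
begin

text \<open>
  Quivers are directed multigraphs (type \<^typ>\<open>('v, 'a) pre_digraph\<close>); an arrow goes from its
  tail to its head.  All vector spaces of a representation are subspaces of one ambient
  vector space of arbitrary dimension, with scalar multiplication \<open>scale\<close>; every family
  of finite dimensional spaces is isomorphic to one of this form.
\<close>

definition fin_dim_subspace :: "('k::field \<Rightarrow> 'b::ab_group_add \<Rightarrow> 'b) \<Rightarrow> 'b set \<Rightarrow> bool" where
  "fin_dim_subspace scale S \<longleftrightarrow>
     module.subspace scale S \<and> (\<exists>B. finite B \<and> B \<subseteq> S \<and> module.span scale B = S)"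

definition linear_map_between ::
  "('k::field \<Rightarrow> 'b::ab_group_add \<Rightarrow> 'b) \<Rightarrow> 'b set \<Rightarrow> 'b set \<Rightarrow> ('b \<Rightarrow> 'b) \<Rightarrow> bool" where
  "linear_map_between scale S T f \<longleftrightarrow>
     f \<in> S \<rightarrow> T \<and>
     (\<forall>x\<in>S. \<forall>y\<in>S. f (x + y) = f x + f y) \<and>
     (\<forall>c. \<forall>x\<in>S. f (scale c x) = scale c (f x))"

record ('v, 'a, 'b) quiver_rep =
  vspace :: "'v \<Rightarrow> 'b set"
  vmap :: "'a \<Rightarrow> 'b \<Rightarrow> 'b"

definition is_rep ::
  "('k::field \<Rightarrow> 'b::ab_group_add \<Rightarrow> 'b) \<Rightarrow> ('v, 'a) pre_digraph \<Rightarrow> ('v, 'a, 'b) quiver_rep \<Rightarrow> bool" where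
  "is_rep scale Q X \<longleftrightarrow>
     (\<forall>v\<in>verts Q. fin_dim_subspace scale (vspace X v)) \<and>
     (\<forall>a\<in>arcs Q.
        linear_map_between scale (vspace X (tail Q a)) (vspace X (head Q a)) (vmap X a))"

definition is_subrep ::
  "('k::field \<Rightarrow> 'b::ab_group_add \<Rightarrow> 'b) \<Rightarrow> ('v, 'a) pre_digraph \<Rightarrow>
   ('v, 'a, 'b) quiver_rep \<Rightarrow> ('v, 'a, 'b) quiver_rep \<Rightarrow> bool" where
  "is_subrep scale Q Y X \<longleftrightarrow>
     is_rep scale Q Y \<and>
     (\<forall>v\<in>verts Q. vspace Y v \<subseteq> vspace X v) \<and>
     (\<forall>a\<in>arcs Q. \<forall>x\<in>vspace Y (tail Q a). vmap Y a x = vmap X a x)"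

definition dim_vec ::
  "('k::field \<Rightarrow> 'b::ab_group_add \<Rightarrow> 'b) \<Rightarrow> ('v, 'a, 'b) quiver_rep \<Rightarrow> 'v \<Rightarrow> nat" where
  "dim_vec scale X v = vector_space.dim scale (vspace X v)"

definition stab_value :: "('v, 'a) pre_digraph \<Rightarrow> ('v \<Rightarrow> int) \<Rightarrow> ('v \<Rightarrow> nat) \<Rightarrow> int" where
  "stab_value Q \<theta> d = (\<Sum>v\<in>verts Q. \<theta> v * int (d v))"

definition semistable ::
  "('k::field \<Rightarrow> 'b::ab_group_add \<Rightarrow> 'b) \<Rightarrow> ('v, 'a) pre_digraph \<Rightarrow> ('v \<Rightarrow> int) \<Rightarrow>
   ('v, 'a, 'b) quiver_rep \<Rightarrow> bool" where
  "semistable scale Q \<theta> X \<longleftrightarrow>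
     stab_value Q \<theta> (dim_vec scale X) = 0 \<and>
     (\<forall>X'. is_subrep scale Q X' X \<longrightarrow> stab_value Q \<theta> (dim_vec scale X') \<le> 0)"

text \<open>
  The free product \<open>A = A\<^sub>1 * ... * A\<^sub>m\<close>, where \<open>A\<^sub>i\<close> is the product of the matrix algebras
  of size \<open>w i j\<close> for \<open>j = 1, ..., r i\<close>, enters only through the numbers \<open>m\<close>, \<open>r\<close>, \<open>w\<close>.
\<close>

text \<open>The dimension of \<open>A\<^sub>i\<close>: a matrix algebra of size \<open>n\<close> has dimension \<open>n\<^sup>2\<close>.\<close>

definition factor_dim :: "(nat \<Rightarrow> nat) \<Rightarrow> (nat \<Rightarrow> nat \<Rightarrow> nat) \<Rightarrow> nat \<Rightarrow> nat" where
  "factor_dim r w i = (\<Sum>j = 1..r i. (w i j)\<^sup>2)"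

text \<open>\<open>Sink\<close> is \<open>v\<^sub>0\<close>, \<open>Source i j\<close> is \<open>v\<^sub>i\<^sub>j\<close>, and \<open>Arrow i j k\<close> is the \<open>k\<close>-th arrow from \<open>v\<^sub>i\<^sub>j\<close>.\<close>

datatype vertex = Sink | Source nat nat

datatype arrow = Arrow nat nat nat

fun arrow_source :: "arrow \<Rightarrow> vertex" where
  "arrow_source (Arrow i j k) = Source i j"

definition Gamma ::
  "nat \<Rightarrow> (nat \<Rightarrow> nat) \<Rightarrow> (nat \<Rightarrow> nat \<Rightarrow> nat) \<Rightarrow> (vertex, arrow) pre_digraph" where
  "Gamma m r w =
     \<lparr> verts = insert Sink {Source i j | i j. i \<in> {1..m} \<and> j \<in> {1..r i}},
       arcs = {Arrow i j k | i j k. i \<in> {1..m} \<and> j \<in> {1..r i} \<and> k \<in> {1..w i j}},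
       tail = arrow_source,
       head = (\<lambda>_. Sink) \<rparr>"

fun theta :: "nat \<Rightarrow> (nat \<Rightarrow> nat \<Rightarrow> nat) \<Rightarrow> vertex \<Rightarrow> int" where
  "theta m w Sink = - int m"
| "theta m w (Source i j) = int (w i j)"

text \<open>
  The domain of \<open>\<Psi>(X, i)\<close> is the external direct sum of one copy of \<open>X(v\<^sub>i\<^sub>j)\<close> for each pair
  \<open>(j, k)\<close>, realised as extensional families.  Being linear, \<open>\<Psi>(X, i)\<close> is invertible
  precisely when it is bijective.
\<close>

definition Psi_index :: "(nat \<Rightarrow> nat) \<Rightarrow> (nat \<Rightarrow> nat \<Rightarrow> nat) \<Rightarrow> nat \<Rightarrow> (nat \<times> nat) set" where
  "Psi_index r w i = (SIGMA j : {1..r i}. {1..w i j})"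

definition Psi_domain ::
  "(nat \<Rightarrow> nat) \<Rightarrow> (nat \<Rightarrow> nat \<Rightarrow> nat) \<Rightarrow> (vertex, arrow, 'b) quiver_rep \<Rightarrow> nat \<Rightarrow>
   (nat \<times> nat \<Rightarrow> 'b) set" where
  "Psi_domain r w X i = (\<Pi>\<^sub>E (j, k) \<in> Psi_index r w i. vspace X (Source i j))"

definition Psi ::
  "(nat \<Rightarrow> nat) \<Rightarrow> (nat \<Rightarrow> nat \<Rightarrow> nat) \<Rightarrow> (vertex, arrow, 'b::ab_group_add) quiver_rep \<Rightarrow> nat \<Rightarrow>
   (nat \<times> nat \<Rightarrow> 'b) \<Rightarrow> 'b" where
  "Psi r w X i x = (\<Sum>(j, k) \<in> Psi_index r w i. vmap X (Arrow i j k) (x (j, k)))"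

definition balanced ::
  "nat \<Rightarrow> (nat \<Rightarrow> nat) \<Rightarrow> (nat \<Rightarrow> nat \<Rightarrow> nat) \<Rightarrow> (vertex, arrow, 'b::ab_group_add) quiver_rep \<Rightarrow> bool" where
  "balanced m r w X \<longleftrightarrow>
     (\<forall>i\<in>{1..m}. bij_betw (Psi r w X i) (Psi_domain r w X i) (vspace X Sink))"

end

theory Submission
  imports Defs
begin

text \<open>
  Split the weight \<open>- m\<close> of the sink evenly among the factors: \<open>\<theta>(dim Y)\<close> becomes the sum over
  \<open>i = 1, ..., m\<close> of the difference between the dimension of the domain of \<open>\<Psi>(Y, i)\<close>, which is
  \<open>\<Sum>\<^sub>j w\<^sub>i\<^sub>j dim Y(v\<^sub>i\<^sub>j)\<close>, and the dimension of its codomain \<open>Y(v\<^sub>0)\<close>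
  (\<open>stab_value_theta_eq\<close>).  If \<open>X\<close> is balanced and \<open>Y\<close> is a subrepresentation, then \<open>\<Psi>(Y, i)\<close>
  is a restriction of \<open>\<Psi>(X, i)\<close>, hence injective, so every difference is nonpositive, and it
  vanishes exactly when \<open>\<Psi>(Y, i)\<close> is onto (\<open>direct_sum_map_dim\<close>).  A sum of nonpositive terms
  vanishes iff all of them do, which gives part (2); part (1) is the case \<open>Y = X\<close>, and part (3)
  combines the two.

  The ambient space may have infinite dimension and the domain of \<open>\<Psi>\<close> consists of extensional
  families, outside of any vector space type.  The dimension count therefore takes place in the
  codomain: an injective linear map out of a direct sum sends bases of the summands to a basis of its
  image (\<open>dim_direct_sum_image\<close>).
\<close>

section \<open>Dimensions of images of direct sums\<close>

context vector_space
begin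

lemma fin_dim_subspace_basis:
  assumes "fin_dim_subspace scale S"
  obtains B where "finite B" "B \<subseteq> S" "independent B" "span B = S" "card B = dim S"
proof -
  obtain F where F: "finite F" "span F = S" and S: "subspace S"
    using assms unfolding fin_dim_subspace_def by blast
  obtain B where B: "B \<subseteq> S" "independent B" "S \<subseteq> span B" "card B = dim S"
    using basis_exists[of S] by blast
  have "finite B"
    using independent_span_bound[of F B] F B by auto
  moreover have "span B = S"
    using B S by (simp add: span_minimal subset_antisym)
  ultimately show ?thesis using that B by blast
qed

text \<open>
  A basis of a subspace extends to a basis of the finite dimensional space around it, so only
  the latter has to be finitely generated.
\<close>

lemma fin_dim_subspace_dim_mono:
  assumes U: "subspace U" "U \<subseteq> T" and T: "fin_dim_subspace scale T"
  shows "dim U \<le> dim T" and "dim U = dim T \<longleftrightarrow> U = T"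
proof -
  obtain F where F: "finite F" "span F = T"
    using T unfolding fin_dim_subspace_def by blast
  obtain C where C: "C \<subseteq> U" "independent C" "U \<subseteq> span C" "card C = dim U"
    using basis_exists[of U] by blast
  obtain D where D: "C \<subseteq> D" "D \<subseteq> T" "independent D" "T \<subseteq> span D"
    using maximal_independent_subset_extend[of C T] C U by blast
  have finD: "finite D"
    using independent_span_bound[of F D] F D by auto
  have dimT: "card D = dim T"
    using D basis_card_eq_dim[of D T] by blast
  show "dim U \<le> dim T"
    using card_mono[OF finD D(1)] C dimT by simp
  show "dim U = dim T \<longleftrightarrow> U = T"
  proof
    assume "dim U = dim T"
    then have "C = D"
      using card_subset_eq[OF finD D(1)] C dimT by simp
    then show "U = T"
      using C D U span_minimal[of C U] by blast
  qed simp
qed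

lemma linear_map_between_zero:
  assumes "linear_map_between scale S T f" "subspace S"
  shows "f 0 = 0"
proof -
  have "f (scale 0 0) = scale 0 (f 0)"
    using assms subspace_0 unfolding linear_map_between_def by blast
  then show ?thesis by simp
qed

lemma linear_map_between_sum:
  assumes f: "linear_map_between scale S T f" and S: "subspace S"
    and "finite B" "B \<subseteq> S"
  shows "f (\<Sum>b\<in>B. scale (u b) b) = (\<Sum>b\<in>B. scale (u b) (f b))"
  using assms(3,4)
proof (induction B)
  case empty
  then show ?case using linear_map_between_zero[OF f S] by simp
next
  case (insert b B)
  have "(\<Sum>b\<in>B. scale (u b) b) \<in> S"
    using insert S by (intro subspace_sum subspace_scale) auto
  moreover have "scale (u b) b \<in> S"
    using insert S by (intro subspace_scale) auto
  ultimately show ?case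
    using insert f unfolding linear_map_between_def by auto
qed

lemma direct_sum_image_subspace:
  assumes S: "\<And>p. p \<in> I \<Longrightarrow> subspace (S p)"
    and f: "\<And>p. p \<in> I \<Longrightarrow> linear_map_between scale (S p) T (f p)"
  shows "subspace ((\<lambda>x. \<Sum>p\<in>I. f p (x p)) ` (\<Pi>\<^sub>E p\<in>I. S p))" (is "subspace (?\<Phi> ` ?D)")
proof (rule subspaceI)
  have eq: "?\<Phi> (\<lambda>p\<in>I. 0) = 0"
    using linear_map_between_zero[OF f S] by (intro sum.neutral) simp
  have mem: "(\<lambda>p\<in>I. 0) \<in> ?D"
    using S by (auto intro: subspace_0)
  show "0 \<in> ?\<Phi> ` ?D"
    by (rule rev_image_eqI[OF mem]) (rule eq[symmetric])
next
  fix a b assume "a \<in> ?\<Phi> ` ?D" "b \<in> ?\<Phi> ` ?D"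
  then obtain x y where x: "x \<in> ?D" "a = ?\<Phi> x" and y: "y \<in> ?D" "b = ?\<Phi> y" by blast
  have mem: "x p \<in> S p" "y p \<in> S p" if "p \<in> I" for p
    using that x y by (auto simp: PiE_mem)
  have "?\<Phi> (\<lambda>p\<in>I. x p + y p) = (\<Sum>p\<in>I. f p (x p) + f p (y p))"
    using f mem unfolding linear_map_between_def by (intro sum.cong) auto
  then have eq: "?\<Phi> (\<lambda>p\<in>I. x p + y p) = a + b"
    using x y by (simp add: sum.distrib)
  have sum_mem: "(\<lambda>p\<in>I. x p + y p) \<in> ?D"
    using mem S by (auto intro: subspace_add)
  show "a + b \<in> ?\<Phi> ` ?D"
    by (rule rev_image_eqI[OF sum_mem]) (rule eq[symmetric])
next
  fix c a assume "a \<in> ?\<Phi> ` ?D"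
  then obtain x where x: "x \<in> ?D" "a = ?\<Phi> x" by blast
  have mem: "x p \<in> S p" if "p \<in> I" for p
    using that x by (auto simp: PiE_mem)
  have "?\<Phi> (\<lambda>p\<in>I. scale c (x p)) = (\<Sum>p\<in>I. scale c (f p (x p)))"
    using f mem unfolding linear_map_between_def by (intro sum.cong) auto
  then have eq: "?\<Phi> (\<lambda>p\<in>I. scale c (x p)) = scale c a"
    using x by (simp add: scale_sum_right)
  have scale_mem: "(\<lambda>p\<in>I. scale c (x p)) \<in> ?D"
    using mem S by (auto intro: subspace_scale)
  show "scale c a \<in> ?\<Phi> ` ?D"
    by (rule rev_image_eqI[OF scale_mem]) (rule eq[symmetric])
qed

text \<open>
  The dimension of a direct sum is additive, read off in the image of an injective linear map:
  bases of the summands map to distinct vectors that together form a basis of the image.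
\<close>

lemma dim_direct_sum_image:
  fixes I :: "'i set" and S :: "'i \<Rightarrow> 'b set" and f :: "'i \<Rightarrow> 'b \<Rightarrow> 'b"
  assumes I: "finite I"
    and S: "\<And>p. p \<in> I \<Longrightarrow> fin_dim_subspace scale (S p)"
    and f: "\<And>p. p \<in> I \<Longrightarrow> linear_map_between scale (S p) T (f p)"
    and inj: "inj_on (\<lambda>x. \<Sum>p\<in>I. f p (x p)) (\<Pi>\<^sub>E p\<in>I. S p)"
  shows "dim ((\<lambda>x. \<Sum>p\<in>I. f p (x p)) ` (\<Pi>\<^sub>E p\<in>I. S p)) = (\<Sum>p\<in>I. dim (S p))"
    (is "dim (?\<Phi> ` ?D) = _")
proof -
  have sub: "subspace (S p)" if "p \<in> I" for p
    using S[OF that] unfolding fin_dim_subspace_def by blast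
  have "\<exists>B. finite B \<and> B \<subseteq> S p \<and> independent B \<and> span B = S p \<and> card B = dim (S p)"
    if "p \<in> I" for p
    using fin_dim_subspace_basis[OF S[OF that]] by metis
  then obtain B where B: "\<And>p. p \<in> I \<Longrightarrow> finite (B p) \<and> B p \<subseteq> S p \<and> independent (B p) \<and>
      span (B p) = S p \<and> card (B p) = dim (S p)"
    by metis
  define P where "P = Sigma I B"
  define g where "g = (\<lambda>(p, b). f p b)"
  have finP: "finite P"
    unfolding P_def using I B by auto
  \<comment> \<open>The inclusion of the summand with index \<open>p\<close> into the direct sum.\<close>
  define single where "single = (\<lambda>p (b :: 'b). \<lambda>q\<in>I. if q = p then b else 0)"
  have single_mem: "single p b \<in> ?D" if "p \<in> I" "b \<in> S p" for p b
    using that unfolding single_def by (auto intro: subspace_0[OF sub])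
  have Phi_single: "?\<Phi> (single p b) = f p b" if "p \<in> I" for p b
  proof -
    have "?\<Phi> (single p b) = (\<Sum>q\<in>I. if q = p then f p b else 0)"
      using linear_map_between_zero[OF f sub] unfolding single_def by (intro sum.cong) auto
    then show ?thesis using I that by simp
  qed
  have inj_g: "inj_on g P"
  proof (rule inj_onI)
    fix s t assume st: "s \<in> P" "t \<in> P" "g s = g t"
    obtain p b where s: "s = (p, b)" "p \<in> I" "b \<in> B p"
      using st(1) unfolding P_def by auto
    obtain q c where t: "t = (q, c)" "q \<in> I" "c \<in> B q"
      using st(2) unfolding P_def by auto
    have "?\<Phi> (single p b) = ?\<Phi> (single q c)"
      using st(3) s t Phi_single unfolding g_def by simp
    then have eq: "single p b = single q c"
      using inj_onD[OF inj] single_mem s t B by (meson subsetD)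
    have "single p b p = b"
      using s unfolding single_def by simp
    moreover have "single q c p = (if p = q then c else 0)"
      using s unfolding single_def by simp
    moreover have "b \<noteq> 0"
      using B[OF s(2)] s(3) dependent_zero by blast
    ultimately show "s = t"
      using eq s t by (auto split: if_splits)
  qed
  have ind: "independent (g ` P)"
  proof (rule independent_if_scalars_zero)
    fix u y assume 0: "(\<Sum>y\<in>g ` P. scale (u y) y) = 0" and y: "y \<in> g ` P"
    \<comment> \<open>A relation among the images is the image of a family in the direct sum, which is zero by
      injectivity; its components are relations among the bases.\<close>
    define x where "x = (\<lambda>p\<in>I. \<Sum>b\<in>B p. scale (u (f p b)) b)"
    have x: "x \<in> ?D"
      unfolding x_def using B sub by (auto intro!: subspace_sum subspace_scale)
    have "?\<Phi> x = (\<Sum>p\<in>I. \<Sum>b\<in>B p. scale (u (f p b)) (f p b))"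
      unfolding x_def using B linear_map_between_sum[OF f sub] by (intro sum.cong) auto
    also have "\<dots> = (\<Sum>t\<in>P. scale (u (g t)) (g t))"
      unfolding P_def g_def using I B by (subst sum.Sigma) (auto simp: case_prod_unfold)
    also have "\<dots> = 0"
      using 0 by (simp add: sum.reindex[OF inj_g])
    also have "\<dots> = ?\<Phi> (\<lambda>p\<in>I. 0)"
      using linear_map_between_zero[OF f sub] by (intro sum.neutral[symmetric]) simp
    finally have "?\<Phi> x = ?\<Phi> (\<lambda>p\<in>I. 0)" .
    moreover note x
    moreover have "(\<lambda>p\<in>I. 0) \<in> ?D"
      by (auto intro: subspace_0[OF sub])
    ultimately have x0: "x = (\<lambda>p\<in>I. 0)"
      by (rule inj_onD[OF inj])
    have rel: "(\<Sum>b\<in>B p. scale (u (f p b)) b) = 0" if "p \<in> I" for p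
      using fun_cong[OF x0, of p] that by (simp add: x_def)
    obtain p b where pb: "p \<in> I" "b \<in> B p" "y = f p b"
      using y unfolding P_def g_def by auto
    have "u (f p b) = 0"
      by (rule independentD[of "B p" "B p" "\<lambda>b. u (f p b)"])
        (use B[OF pb(1)] rel[OF pb(1)] pb(2) in blast)+
    then show "u y = 0"
      using pb(3) by simp
  qed (use finP in simp)
  have "g ` P \<subseteq> ?\<Phi> ` ?D"
  proof
    fix y assume "y \<in> g ` P"
    then obtain p b where pb: "p \<in> I" "b \<in> B p" "y = f p b"
      unfolding P_def g_def by auto
    then have mem: "single p b \<in> ?D"
      using single_mem B by blast
    show "y \<in> ?\<Phi> ` ?D"
      using Phi_single pb by (intro rev_image_eqI[OF mem]) simp
  qed
  moreover have "?\<Phi> ` ?D \<subseteq> span (g ` P)"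
  proof (intro image_subsetI span_sum)
    fix x p assume x: "x \<in> ?D" and p: "p \<in> I"
    then have "x p \<in> span (B p)"
      using B by (auto simp: PiE_mem)
    then have "x p \<in> range (\<lambda>u. \<Sum>b\<in>B p. scale (u b) b)"
      using B[OF p] span_finite by blast
    then obtain u where u: "x p = (\<Sum>b\<in>B p. scale (u b) b)"
      by (rule rangeE)
    have "f p (x p) = (\<Sum>b\<in>B p. scale (u b) (f p b))"
      unfolding u using linear_map_between_sum[OF f[OF p] sub[OF p]] B[OF p] by blast
    moreover have "f p b \<in> g ` P" if "b \<in> B p" for b
      using that p unfolding P_def g_def by force
    ultimately show "f p (x p) \<in> span (g ` P)"
      by (simp add: span_sum span_scale span_base)
  qed
  ultimately have "dim (?\<Phi> ` ?D) = card (g ` P)"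
    using basis_card_eq_dim[of "g ` P", OF _ _ ind] by simp
  also have "\<dots> = card P"
    by (rule card_image[OF inj_g])
  also have "\<dots> = (\<Sum>p\<in>I. dim (S p))"
    unfolding P_def using I B by simp
  finally show ?thesis .
qed

text \<open>
  The image is a subspace of the codomain, of dimension \<open>\<Sum>\<^sub>p dim S\<^sub>p\<close>; so this
  number is a lower bound for \<open>dim T\<close>, attained exactly when the map is onto.
\<close>

lemma direct_sum_map_dim:
  fixes I :: "'i set" and S :: "'i \<Rightarrow> 'b set" and f :: "'i \<Rightarrow> 'b \<Rightarrow> 'b"
  assumes I: "finite I"
    and S: "\<And>p. p \<in> I \<Longrightarrow> fin_dim_subspace scale (S p)"
    and T: "fin_dim_subspace scale T"
    and f: "\<And>p. p \<in> I \<Longrightarrow> linear_map_between scale (S p) T (f p)"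
    and inj: "inj_on (\<lambda>x. \<Sum>p\<in>I. f p (x p)) (\<Pi>\<^sub>E p\<in>I. S p)"
  shows "(\<Sum>p\<in>I. dim (S p)) \<le> dim T"
    and "(\<Sum>p\<in>I. dim (S p)) = dim T \<longleftrightarrow>
      bij_betw (\<lambda>x. \<Sum>p\<in>I. f p (x p)) (\<Pi>\<^sub>E p\<in>I. S p) T" (is "_ \<longleftrightarrow> bij_betw ?\<Phi> ?D T")
proof -
  have "subspace (?\<Phi> ` ?D)"
    using S f unfolding fin_dim_subspace_def by (intro direct_sum_image_subspace) auto
  moreover have "?\<Phi> ` ?D \<subseteq> T"
  proof (rule image_subsetI)
    fix x assume x: "x \<in> ?D"
    have "f p (x p) \<in> T" if "p \<in> I" for p
      using f[OF that] PiE_mem[OF x that] unfolding linear_map_between_def by blast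
    then show "?\<Phi> x \<in> T"
      using T unfolding fin_dim_subspace_def by (blast intro: subspace_sum)
  qed
  ultimately have "dim (?\<Phi> ` ?D) \<le> dim T"
    and "dim (?\<Phi> ` ?D) = dim T \<longleftrightarrow> ?\<Phi> ` ?D = T"
    by (rule fin_dim_subspace_dim_mono[OF _ _ T])+
  moreover have "dim (?\<Phi> ` ?D) = (\<Sum>p\<in>I. dim (S p))"
    using I S f inj by (rule dim_direct_sum_image)
  ultimately show "(\<Sum>p\<in>I. dim (S p)) \<le> dim T"
    and "(\<Sum>p\<in>I. dim (S p)) = dim T \<longleftrightarrow> bij_betw ?\<Phi> ?D T"
    using inj by (simp_all add: bij_betw_def)
qed

end

section \<open>The stability parameter and the maps \<open>\<Psi>\<close>\<close>

text \<open>
  The sum over \<open>Psi_index\<close> is the dimension of the domain of \<open>\<Psi>\<close>, with one copy of each source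
  space for every arrow leaving it; the weight \<open>- m\<close> of the sink subtracts one copy of
  \<open>d v\<^sub>0\<close> for each factor.
\<close>

lemma stab_value_theta_eq:
  "stab_value (Gamma m r w) (theta m w) d =
    (\<Sum>i = 1..m. int (\<Sum>(j, k)\<in>Psi_index r w i. d (Source i j)) - int (d Sink))"
proof -
  let ?P = "SIGMA i : {1..m}. {1..r i}"
  have verts: "verts (Gamma m r w) = insert Sink ((\<lambda>(i, j). Source i j) ` ?P)"
    unfolding Gamma_def by auto
  have inj: "inj_on (\<lambda>(i, j). Source i j) ?P"
    by (auto intro: inj_onI)
  have "stab_value (Gamma m r w) (theta m w) d =
      - int m * int (d Sink) +
      (\<Sum>v\<in>(\<lambda>(i, j). Source i j) ` ?P. theta m w v * int (d v))"
    unfolding stab_value_def verts by (subst sum.insert) auto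
  also have "(\<Sum>v\<in>(\<lambda>(i, j). Source i j) ` ?P. theta m w v * int (d v)) =
      (\<Sum>i = 1..m. \<Sum>j = 1..r i. int (w i j) * int (d (Source i j)))"
    by (subst sum.reindex[OF inj]) (simp add: sum.Sigma case_prod_unfold)
  also have "\<dots> = (\<Sum>i = 1..m. int (\<Sum>(j, k)\<in>Psi_index r w i. d (Source i j)))"
  proof (rule sum.cong[OF refl])
    fix i
    have "(\<Sum>(j, k)\<in>Psi_index r w i. d (Source i j)) = (\<Sum>j = 1..r i. \<Sum>k = 1..w i j. d (Source i j))"
      unfolding Psi_index_def by (subst sum.Sigma) auto
    then show "(\<Sum>j = 1..r i. int (w i j) * int (d (Source i j))) =
        int (\<Sum>(j, k)\<in>Psi_index r w i. d (Source i j))"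
      by simp
  qed
  finally show ?thesis
    by (simp add: sum_subtractf)
qed

lemma Psi_dim:
  assumes "vector_space scale" and Y: "is_rep scale (Gamma m r w) Y" and i: "i \<in> {1..m}"
    and inj: "inj_on (Psi r w Y i) (Psi_domain r w Y i)"
  shows "(\<Sum>(j, k)\<in>Psi_index r w i. dim_vec scale Y (Source i j)) \<le> dim_vec scale Y Sink"
    and "(\<Sum>(j, k)\<in>Psi_index r w i. dim_vec scale Y (Source i j)) = dim_vec scale Y Sink \<longleftrightarrow>
      bij_betw (Psi r w Y i) (Psi_domain r w Y i) (vspace Y Sink)"
proof -
  interpret vector_space scale by fact
  let ?I = "Psi_index r w i"
  let ?S = "\<lambda>p. vspace Y (Source i (fst p))"
  let ?f = "\<lambda>p. vmap Y (Arrow i (fst p) (snd p))"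
  have Psi: "Psi r w Y i = (\<lambda>x. \<Sum>p\<in>?I. ?f p (x p))"
    unfolding Psi_def by (simp add: fun_eq_iff case_prod_unfold)
  have dom: "Psi_domain r w Y i = (\<Pi>\<^sub>E p\<in>?I. ?S p)"
    unfolding Psi_domain_def by (simp add: case_prod_unfold)
  have fin: "finite ?I"
    unfolding Psi_index_def by simp
  have S: "fin_dim_subspace scale (?S p)" if "p \<in> ?I" for p
    using Y that i unfolding is_rep_def Gamma_def Psi_index_def by auto
  have T: "fin_dim_subspace scale (vspace Y Sink)"
    using Y unfolding is_rep_def Gamma_def by auto
  have f: "linear_map_between scale (?S p) (vspace Y Sink) (?f p)" if "p \<in> ?I" for p
  proof -
    have "Arrow i (fst p) (snd p) \<in> arcs (Gamma m r w)"
      using that i unfolding Gamma_def Psi_index_def by auto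
    then have "linear_map_between scale
        (vspace Y (tail (Gamma m r w) (Arrow i (fst p) (snd p))))
        (vspace Y (head (Gamma m r w) (Arrow i (fst p) (snd p)))) (?f p)"
      using Y unfolding is_rep_def by blast
    then show ?thesis by (simp add: Gamma_def)
  qed
  note core = direct_sum_map_dim[where S = ?S and f = ?f, OF fin S T f]
  show "(\<Sum>(j, k)\<in>?I. dim_vec scale Y (Source i j)) \<le> dim_vec scale Y Sink"
    using core(1) inj unfolding Psi dom by (simp add: dim_vec_def case_prod_unfold)
  show "(\<Sum>(j, k)\<in>?I. dim_vec scale Y (Source i j)) = dim_vec scale Y Sink \<longleftrightarrow>
      bij_betw (Psi r w Y i) (Psi_domain r w Y i) (vspace Y Sink)"
    using core(2) inj unfolding Psi dom by (simp add: dim_vec_def case_prod_unfold)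
qed

lemma stab_value_if_Psi_inj:
  assumes "vector_space scale" "is_rep scale (Gamma m r w) Y"
    and inj: "\<And>i. i \<in> {1..m} \<Longrightarrow> inj_on (Psi r w Y i) (Psi_domain r w Y i)"
  shows "stab_value (Gamma m r w) (theta m w) (dim_vec scale Y) \<le> 0"
    and "stab_value (Gamma m r w) (theta m w) (dim_vec scale Y) = 0 \<longleftrightarrow> balanced m r w Y"
proof -
  define D where
    "D i = int (\<Sum>(j, k)\<in>Psi_index r w i. dim_vec scale Y (Source i j)) - int (dim_vec scale Y Sink)"
    for i
  have stab: "stab_value (Gamma m r w) (theta m w) (dim_vec scale Y) = (\<Sum>i = 1..m. D i)"
    unfolding D_def by (rule stab_value_theta_eq)
  have le: "D i \<le> 0" if "i \<in> {1..m}" for i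
    using Psi_dim(1)[OF assms(1,2) that inj[OF that]] unfolding D_def by linarith
  have eq: "D i = 0 \<longleftrightarrow> bij_betw (Psi r w Y i) (Psi_domain r w Y i) (vspace Y Sink)"
    if "i \<in> {1..m}" for i
    using Psi_dim(2)[OF assms(1,2) that inj[OF that]] unfolding D_def by linarith
  show "stab_value (Gamma m r w) (theta m w) (dim_vec scale Y) \<le> 0"
    unfolding stab using le by (rule sum_nonpos)
  have "(\<Sum>i = 1..m. D i) = 0 \<longleftrightarrow> (\<forall>i\<in>{1..m}. D i = 0)"
    using sum_nonneg_eq_0_iff[of "{1..m}" "\<lambda>i. - D i"] le by (simp add: sum_negf)
  then show "stab_value (Gamma m r w) (theta m w) (dim_vec scale Y) = 0 \<longleftrightarrow> balanced m r w Y"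
    unfolding stab balanced_def using eq by blast
qed

lemma subrep_Psi_inj:
  assumes Y: "is_subrep scale (Gamma m r w) Y X" and i: "i \<in> {1..m}"
    and inj: "inj_on (Psi r w X i) (Psi_domain r w X i)"
  shows "inj_on (Psi r w Y i) (Psi_domain r w Y i)"
proof -
  have sub: "vspace Y (Source i j) \<subseteq> vspace X (Source i j)" if "j \<in> {1..r i}" for j
    using Y i that unfolding is_subrep_def Gamma_def by auto
  have agree: "vmap Y (Arrow i j k) y = vmap X (Arrow i j k) y"
    if "j \<in> {1..r i}" "k \<in> {1..w i j}" "y \<in> vspace Y (Source i j)" for j k y
  proof -
    have "Arrow i j k \<in> arcs (Gamma m r w)"
      using i that unfolding Gamma_def by auto
    moreover have "y \<in> vspace Y (tail (Gamma m r w) (Arrow i j k))"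
      using that unfolding Gamma_def by simp
    ultimately show ?thesis using Y unfolding is_subrep_def by blast
  qed
  have "Psi_domain r w Y i \<subseteq> Psi_domain r w X i"
    unfolding Psi_domain_def
  proof (rule PiE_mono)
    fix p assume "p \<in> Psi_index r w i"
    then show "(case p of (j, k) \<Rightarrow> vspace Y (Source i j)) \<subseteq>
        (case p of (j, k) \<Rightarrow> vspace X (Source i j))"
      using sub[of "fst p"] by (auto simp: Psi_index_def)
  qed
  then have "inj_on (Psi r w X i) (Psi_domain r w Y i)"
    by (rule inj_on_subset[OF inj])
  moreover have "Psi r w X i x = Psi r w Y i x" if x: "x \<in> Psi_domain r w Y i" for x
  proof -
    have "x (j, k) \<in> vspace Y (Source i j)" if "(j, k) \<in> Psi_index r w i" for j k
      using PiE_mem[OF x[unfolded Psi_domain_def] that] by simp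
    then show ?thesis
      unfolding Psi_def by (intro sum.cong) (auto simp: agree Psi_index_def)
  qed
  ultimately show ?thesis
    using inj_on_cong by blast
qed

section \<open>Balanced representations are semistable\<close>

theorem proposition3p3:
  fixes scale :: "'k::alg_closed_field \<Rightarrow> 'b::ab_group_add \<Rightarrow> 'b"
    and m :: nat and r :: "nat \<Rightarrow> nat" and w :: "nat \<Rightarrow> nat \<Rightarrow> nat"
    and X :: "(vertex, arrow, 'b) quiver_rep"
  assumes "vector_space scale"
    and "m \<ge> 1"
    and "\<And>i j. i \<in> {1..m} \<Longrightarrow> j \<in> {1..r i} \<Longrightarrow> w i j \<ge> 1"
    and "\<And>i. i \<in> {1..m} \<Longrightarrow> factor_dim r w i \<noteq> 1"
    and "is_rep scale (Gamma m r w) X"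
    and "balanced m r w X"
  shows "stab_value (Gamma m r w) (theta m w) (dim_vec scale X) = 0 \<and>
    (\<forall>Y. is_subrep scale (Gamma m r w) Y X \<longrightarrow>
       stab_value (Gamma m r w) (theta m w) (dim_vec scale Y) \<le> 0 \<and>
       (stab_value (Gamma m r w) (theta m w) (dim_vec scale Y) = 0 \<longleftrightarrow> balanced m r w Y)) \<and>
    semistable scale (Gamma m r w) (theta m w) X"
proof -
  have inj: "inj_on (Psi r w X i) (Psi_domain r w X i)" if "i \<in> {1..m}" for i
    using \<open>balanced m r w X\<close> that unfolding balanced_def bij_betw_def by blast
  have zero: "stab_value (Gamma m r w) (theta m w) (dim_vec scale X) = 0"
    using stab_value_if_Psi_inj(2)[OF assms(1,5) inj] assms(6) by blast
  have sub: "stab_value (Gamma m r w) (theta m w) (dim_vec scale Y) \<le> 0 \<and>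
      (stab_value (Gamma m r w) (theta m w) (dim_vec scale Y) = 0 \<longleftrightarrow> balanced m r w Y)"
    if Y: "is_subrep scale (Gamma m r w) Y X" for Y
  proof -
    have "is_rep scale (Gamma m r w) Y"
      using Y unfolding is_subrep_def by blast
    then show ?thesis
      using stab_value_if_Psi_inj[OF assms(1) _ subrep_Psi_inj[OF Y _ inj]] by blast
  qed
  show ?thesis
    using zero sub unfolding semistable_def by blast
qed

end
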